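(* For all positive integers $n,k$ such that $n+k\equiv1\pmod2$, we have in $\mathcal A$ $$T_{\mathcal A}(n,2,\{1\}^k)=T_{\mathcal A}(k+1,2,\{1\}^{n-1}).$$ Equivalently, for all positive integers $n,k$, $$T_{\mathcal A}(2n-1,2,\{1\}^{2k})=-T_{\mathcal A}(\{1\}^{2n-2},2,2k+1),$$ $$T_{\mathcal A}(2n,2,\{1\}^{2k-1})=-S_{\mathcal A}(\{1\}^{2n-1},2,2k).$$
   Context: Let $\mathcal P$ be the set of primes and $\mathcal A=\prod_{p\in\mathcal P}(\mathbb Z/p\mathbb Z)\big/\bigoplus_{p\in\mathcal P}(\mathbb Z/p\mathbb Z)$; two elements are equal iff their components agree for all but finitely many $p$. $\{1\}^m$ denotes the string $1,\dots,1$ of length $m$ (empty if $m=0$). For positive integers $s_1,\dots,s_d$, $T_{\mathcal A}(s_1,\dots,s_d)$ and $S_{\mathcal A}(s_1,\dots,s_d)$ are the classes in $\mathcal A$ of the tuples whose $p$-components are $\sum\frac{2^d}{n_1^{s_1}\cdots n_d^{s_d}}\bmod p$, summed over $p>n_1>\dots>n_d>0$ with $n_j\equiv d-j+1\pmod 2$ for all $j$ (for $T$), respectively $n_j\equiv d-j\pmod 2$ for all $j$ (for $S$). *)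

theory Defs
  imports
    "HOL-Number_Theory.Residues"
    "HOL-Number_Theory.Modular_Inverse"
    "HOL-Algebra.QuotRing"
begin

section \<open>The ring of residues modulo almost all primes\<close>

definition primes :: "nat set" where
  "primes = {p. prime p}"

definition prod_ring :: "(nat \<Rightarrow> int) ring" where
  "prod_ring =
     \<lparr>carrier = (\<Pi>\<^sub>E p\<in>primes. carrier (residue_ring (int p))),
      monoid.mult = \<lambda>x y. \<lambda>p\<in>primes. x p \<otimes>\<^bsub>residue_ring (int p)\<^esub> y p,
      one = \<lambda>p\<in>primes. \<one>\<^bsub>residue_ring (int p)\<^esub>,
      zero = \<lambda>p\<in>primes. \<zero>\<^bsub>residue_ring (int p)\<^esub>,
      add = \<lambda>x y. \<lambda>p\<in>primes. x p \<oplus>\<^bsub>residue_ring (int p)\<^esub> y p\<rparr>"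

definition sum_ideal :: "(nat \<Rightarrow> int) set" where
  "sum_ideal = {x \<in> carrier prod_ring.
     finite {p \<in> primes. x p \<noteq> \<zero>\<^bsub>residue_ring (int p)\<^esub>}}"

definition ring_A :: "(nat \<Rightarrow> int) set ring" where
  "ring_A = prod_ring Quot sum_ideal"

text \<open>The class of a tuple of integers, the component at \<open>p\<close> being read modulo \<open>p\<close>.\<close>

definition class_A :: "(nat \<Rightarrow> int) \<Rightarrow> (nat \<Rightarrow> int) set" where
  "class_A f = sum_ideal +>\<^bsub>prod_ring\<^esub> (\<lambda>p\<in>primes. f p mod int p)"


section \<open>The multiple sums\<close>

text \<open>
  A tuple \<open>n\<^sub>1 > \<dots> > n\<^sub>d\<close> is a list, so that \<open>n\<^sub>j\<close> is the list entry with
  index \<open>j - 1\<close>. The shift \<open>e\<close> in the parity condition is 1 for \<open>T\<close> and 0 for \<open>S\<close>.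
\<close>

definition index_tuples :: "nat \<Rightarrow> nat \<Rightarrow> nat \<Rightarrow> nat list set" where
  "index_tuples e d p =
     {ns. length ns = d \<and> sorted_wrt (>) ns \<and> set ns \<subseteq> {0<..<p} \<and>
          (\<forall>j\<in>{1..d}. [ns ! (j - 1) = d - j + e] (mod 2))}"

text \<open>
  All entries of an index tuple lie strictly between \<open>0\<close> and \<open>p\<close>, so for prime \<open>p\<close> the
  modular inverses below are genuine inverses.
\<close>

definition parity_sum :: "nat \<Rightarrow> nat list \<Rightarrow> nat \<Rightarrow> int" where
  "parity_sum e s p =
     (\<Sum>ns\<in>index_tuples e (length s) p.
        2 ^ length s *
        (\<Prod>j\<in>{1..length s}. modular_inverse (int p) (int (ns ! (j - 1))) ^ (s ! (j - 1))))"

definition T_A :: "nat list \<Rightarrow> (nat \<Rightarrow> int) set" where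
  "T_A s = class_A (parity_sum 1 s)"

definition S_A :: "nat list \<Rightarrow> (nat \<Rightarrow> int) set" where
  "S_A s = class_A (parity_sum 0 s)"


section \<open>Basic facts\<close>

lemma primes_gt_1: "p \<in> primes \<Longrightarrow> p > 1"
  using prime_gt_1_nat[of p] by (simp add: primes_def)

lemma carrier_prod_ring_iff:
  "x \<in> carrier prod_ring \<longleftrightarrow> x \<in> extensional primes \<and> (\<forall>p\<in>primes. 0 \<le> x p \<and> x p < int p)"
  by (auto simp: prod_ring_def residue_ring_def PiE_iff)

lemma prod_ring_apply:
  assumes "p \<in> primes"
  shows "(x \<oplus>\<^bsub>prod_ring\<^esub> y) p = (x p + y p) mod int p"
    and "(x \<otimes>\<^bsub>prod_ring\<^esub> y) p = (x p * y p) mod int p"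
    and "\<zero>\<^bsub>prod_ring\<^esub> p = 0"
    and "\<one>\<^bsub>prod_ring\<^esub> p = 1"
  using assms by (simp_all add: prod_ring_def residue_ring_def)

lemma prod_ring_closed:
  "x \<oplus>\<^bsub>prod_ring\<^esub> y \<in> carrier prod_ring"
  "x \<otimes>\<^bsub>prod_ring\<^esub> y \<in> carrier prod_ring"
  "\<zero>\<^bsub>prod_ring\<^esub> \<in> carrier prod_ring"
  "\<one>\<^bsub>prod_ring\<^esub> \<in> carrier prod_ring"
  unfolding carrier_prod_ring_iff
  by (auto simp: prod_ring_apply dest: primes_gt_1) (auto simp: prod_ring_def)

lemma tuple_in_carrier: "(\<lambda>p\<in>primes. f p mod int p) \<in> carrier prod_ring"
  by (auto simp: carrier_prod_ring_iff dest: primes_gt_1)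

lemma prod_ring_eqI:
  assumes "x \<in> carrier prod_ring" "y \<in> carrier prod_ring" "\<And>p. p \<in> primes \<Longrightarrow> x p = y p"
  shows "x = y"
  using assms by (auto simp: carrier_prod_ring_iff intro: extensionalityI)

lemma prod_ring_add_inverse:
  assumes "x \<in> carrier prod_ring"
  shows "(\<lambda>p\<in>primes. (- x p) mod int p) \<oplus>\<^bsub>prod_ring\<^esub> x = \<zero>\<^bsub>prod_ring\<^esub>"
  by (rule prod_ring_eqI) (simp_all add: prod_ring_closed prod_ring_apply mod_simps)

lemma cring_prod_ring: "cring prod_ring"
proof (rule cringI)
  show "abelian_group prod_ring"
  proof (rule abelian_groupI)
    fix x y z
    assume "x \<in> carrier prod_ring" "y \<in> carrier prod_ring" "z \<in> carrier prod_ring"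
    show "x \<oplus>\<^bsub>prod_ring\<^esub> y \<oplus>\<^bsub>prod_ring\<^esub> z
        = x \<oplus>\<^bsub>prod_ring\<^esub> (y \<oplus>\<^bsub>prod_ring\<^esub> z)"
      by (rule prod_ring_eqI) (simp_all add: prod_ring_closed prod_ring_apply mod_simps add.assoc)
  next
    fix x y assume "x \<in> carrier prod_ring" "y \<in> carrier prod_ring"
    show "x \<oplus>\<^bsub>prod_ring\<^esub> y = y \<oplus>\<^bsub>prod_ring\<^esub> x"
      by (rule prod_ring_eqI) (simp_all add: prod_ring_closed prod_ring_apply add.commute)
  next
    fix x assume x: "x \<in> carrier prod_ring"
    then have "0 \<le> x p \<and> x p < int p" if "p \<in> primes" for p
      using that by (simp add: carrier_prod_ring_iff)
    with x show "\<zero>\<^bsub>prod_ring\<^esub> \<oplus>\<^bsub>prod_ring\<^esub> x = x"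
      by (intro prod_ring_eqI) (simp_all add: prod_ring_closed prod_ring_apply)
    show "\<exists>y\<in>carrier prod_ring. y \<oplus>\<^bsub>prod_ring\<^esub> x = \<zero>\<^bsub>prod_ring\<^esub>"
      by (rule bexI[where P = "\<lambda>y. y \<oplus>\<^bsub>prod_ring\<^esub> x = \<zero>\<^bsub>prod_ring\<^esub>",
            OF prod_ring_add_inverse[OF x] tuple_in_carrier])
  qed (simp_all add: prod_ring_closed)
next
  show "comm_monoid prod_ring"
  proof (rule comm_monoidI)
    fix x y z
    assume "x \<in> carrier prod_ring" "y \<in> carrier prod_ring" "z \<in> carrier prod_ring"
    show "x \<otimes>\<^bsub>prod_ring\<^esub> y \<otimes>\<^bsub>prod_ring\<^esub> z
        = x \<otimes>\<^bsub>prod_ring\<^esub> (y \<otimes>\<^bsub>prod_ring\<^esub> z)"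
      by (rule prod_ring_eqI) (simp_all add: prod_ring_closed prod_ring_apply mod_simps mult.assoc)
  next
    fix x assume x: "x \<in> carrier prod_ring"
    then have "0 \<le> x p \<and> x p < int p" if "p \<in> primes" for p
      using that by (simp add: carrier_prod_ring_iff)
    with x show "\<one>\<^bsub>prod_ring\<^esub> \<otimes>\<^bsub>prod_ring\<^esub> x = x"
      by (intro prod_ring_eqI) (simp_all add: prod_ring_closed prod_ring_apply)
  next
    fix x y assume "x \<in> carrier prod_ring" "y \<in> carrier prod_ring"
    show "x \<otimes>\<^bsub>prod_ring\<^esub> y = y \<otimes>\<^bsub>prod_ring\<^esub> x"
      by (rule prod_ring_eqI) (simp_all add: prod_ring_closed prod_ring_apply mult.commute)
  qed (simp_all add: prod_ring_closed)
next
  fix x y z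
  assume "x \<in> carrier prod_ring" "y \<in> carrier prod_ring" "z \<in> carrier prod_ring"
  show "(x \<oplus>\<^bsub>prod_ring\<^esub> y) \<otimes>\<^bsub>prod_ring\<^esub> z
      = x \<otimes>\<^bsub>prod_ring\<^esub> z \<oplus>\<^bsub>prod_ring\<^esub> y \<otimes>\<^bsub>prod_ring\<^esub> z"
    by (rule prod_ring_eqI)
      (simp_all add: prod_ring_closed prod_ring_apply mod_simps distrib_right)
qed

lemma a_inv_prod_ring:
  assumes "x \<in> carrier prod_ring"
  shows "\<ominus>\<^bsub>prod_ring\<^esub> x = (\<lambda>p\<in>primes. (- x p) mod int p)"
proof -
  interpret cring prod_ring by (rule cring_prod_ring)
  show ?thesis
    by (rule minus_equality[OF prod_ring_add_inverse[OF assms] assms tuple_in_carrier])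
qed

lemma sum_ideal_iff:
  "x \<in> sum_ideal \<longleftrightarrow> x \<in> carrier prod_ring \<and> finite {p \<in> primes. x p \<noteq> 0}"
  by (simp add: sum_ideal_def residue_ring_def)

lemma ideal_sum_ideal: "ideal sum_ideal prod_ring"
proof -
  interpret cring prod_ring by (rule cring_prod_ring)
  let ?N = "\<lambda>x. {p \<in> primes. x p \<noteq> (0 :: int)}"
  have neg: "\<ominus>\<^bsub>prod_ring\<^esub> x \<in> sum_ideal" if "x \<in> sum_ideal" for x
  proof -
    from that have x: "x \<in> carrier prod_ring" "finite (?N x)" by (auto simp: sum_ideal_iff)
    have "?N (\<ominus>\<^bsub>prod_ring\<^esub> x) \<subseteq> ?N x" by (auto simp: a_inv_prod_ring[OF x(1)])
    with x show ?thesis by (auto simp: sum_ideal_iff intro: finite_subset)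
  qed
  have add: "x \<oplus>\<^bsub>prod_ring\<^esub> y \<in> sum_ideal" if "x \<in> sum_ideal" "y \<in> sum_ideal" for x y
  proof -
    from that have "finite (?N x \<union> ?N y)" by (auto simp: sum_ideal_iff)
    moreover have "?N (x \<oplus>\<^bsub>prod_ring\<^esub> y) \<subseteq> ?N x \<union> ?N y" by (auto simp: prod_ring_apply)
    ultimately show ?thesis by (auto simp: sum_ideal_iff prod_ring_closed intro: finite_subset)
  qed
  have mult: "x \<otimes>\<^bsub>prod_ring\<^esub> a \<in> sum_ideal" if "a \<in> sum_ideal" for a x
  proof -
    from that have "finite (?N a)" by (auto simp: sum_ideal_iff)
    moreover have "?N (x \<otimes>\<^bsub>prod_ring\<^esub> a) \<subseteq> ?N a" by (auto simp: prod_ring_apply)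
    ultimately show ?thesis by (auto simp: sum_ideal_iff prod_ring_closed intro: finite_subset)
  qed
  have zero: "\<zero>\<^bsub>prod_ring\<^esub> \<in> sum_ideal"
    by (simp add: sum_ideal_iff prod_ring_apply prod_ring_closed cong: conj_cong)
  have sub: "sum_ideal \<subseteq> carrier prod_ring" by (auto simp: sum_ideal_iff)
  show ?thesis
  proof (rule idealI[OF ring_axioms])
    show "subgroup sum_ideal (add_monoid prod_ring)"
    proof (rule add.subgroupI)
      show "sum_ideal \<noteq> {}" using zero by blast
    qed (simp_all add: sub neg add flip: a_inv_def)
  next
    fix a x assume a: "a \<in> sum_ideal" and x: "x \<in> carrier prod_ring"
    show "x \<otimes>\<^bsub>prod_ring\<^esub> a \<in> sum_ideal" using mult[OF a] .
    then show "a \<otimes>\<^bsub>prod_ring\<^esub> x \<in> sum_ideal" using m_comm[OF x] a sub by auto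
  qed
qed

lemma class_A_in_carrier: "class_A f \<in> carrier ring_A"
  using tuple_in_carrier[of f]
  by (auto simp: class_A_def ring_A_def FactRing_def A_RCOSETS_def' a_r_coset_def)

lemma class_A_eq_iff:
  "class_A f = class_A g \<longleftrightarrow> finite {p. prime p \<and> \<not> [f p = g p] (mod int p)}"
proof -
  interpret ideal sum_ideal prod_ring by (rule ideal_sum_ideal)
  define F where "F = (\<lambda>p\<in>primes. f p mod int p)"
  define G where "G = (\<lambda>p\<in>primes. g p mod int p)"
  have F: "F \<in> carrier prod_ring" and G: "G \<in> carrier prod_ring"
    unfolding F_def G_def by (rule tuple_in_carrier)+
  have "class_A f = class_A g \<longleftrightarrow> F \<ominus>\<^bsub>prod_ring\<^esub> G \<in> sum_ideal"
    using quotient_eq_iff_same_a_r_cos[OF ideal_sum_ideal F G]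
    by (simp add: class_A_def F_def G_def)
  also have "\<dots> \<longleftrightarrow> finite {p \<in> primes. (F \<ominus>\<^bsub>prod_ring\<^esub> G) p \<noteq> 0}"
    using minus_closed[OF F G] by (simp add: sum_ideal_iff)
  also have "{p \<in> primes. (F \<ominus>\<^bsub>prod_ring\<^esub> G) p \<noteq> 0}
           = {p. prime p \<and> \<not> [f p = g p] (mod int p)}"
  proof -
    have "(F \<ominus>\<^bsub>prod_ring\<^esub> G) p = (f p - g p) mod int p" if "p \<in> primes" for p
    proof -
      have "(F \<ominus>\<^bsub>prod_ring\<^esub> G) p = (F p + (- G p) mod int p) mod int p"
        using that by (simp add: a_minus_def a_inv_prod_ring[OF G] prod_ring_apply)
      also have "\<dots> = (F p - G p) mod int p"
        by (simp add: mod_add_right_eq)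
      also have "\<dots> = (f p - g p) mod int p"
        using that by (simp add: F_def G_def mod_diff_eq)
      finally show ?thesis .
    qed
    then show ?thesis
      by (auto simp: primes_def cong_iff_dvd_diff dvd_eq_mod_eq_0)
  qed
  finally show ?thesis .
qed

lemma a_inv_class_A: "\<ominus>\<^bsub>ring_A\<^esub> class_A f = class_A (\<lambda>p. - f p)"
proof -
  interpret ideal sum_ideal prod_ring by (rule ideal_sum_ideal)
  interpret h: ring_hom_ring prod_ring ring_A "(+>\<^bsub>prod_ring\<^esub>) sum_ideal"
    unfolding ring_A_def by (rule rcos_ring_hom_ring)
  have "\<ominus>\<^bsub>prod_ring\<^esub> (\<lambda>p\<in>primes. f p mod int p) = (\<lambda>p\<in>primes. (- f p) mod int p)"
    unfolding a_inv_prod_ring[OF tuple_in_carrier] by (auto simp: mod_simps)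
  then show ?thesis
    using h.hom_a_inv[OF tuple_in_carrier, of f] by (simp add: class_A_def)
qed

end

theory Submission
  imports Defs "HOL-Number_Theory.Residue_Primitive_Roots"
begin

text \<open>
  Write \<open>g m b\<close> for the coefficient of \<open>t ^ m\<close> in \<open>((1 + t) / (1 - t)) ^ b\<close>. Since
  \<open>((1 + t) / (1 - t)) ^ x = exp (x * (2 * t + 2 * t ^ 3 / 3 + 2 * t ^ 5 / 5 + \<dots>))\<close>, the
  coefficient \<open>g m x\<close> is a polynomial in \<open>x\<close>, and its coefficient at \<open>x ^ q\<close> is the sum of
  \<open>2 ^ q / (n\<^sub>1 \<dots> n\<^sub>q)\<close> over all \<open>m = n\<^sub>1 > \<dots> > n\<^sub>q > 0\<close> that alternate in parity and end with
  an odd number. Those are the sums that the entries \<open>1\<close> of an index contribute to \<open>T\<close>. For a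
  prime \<open>p > m\<close> all of this makes sense modulo \<open>p\<close>, and since the polynomial has degree less
  than \<open>p\<close>, its coefficient at \<open>x ^ q\<close>, for \<open>0 < q < p - 1\<close>, is the negative of the sum of
  \<open>g m b * b ^ (- q)\<close> over the nonzero residues \<open>b\<close> (lemma \<open>alt_sum_ones_eq_mittag_leffler_transform\<close>).

  Inserting this into \<open>T(n, 2, 1, \<dots>, 1)\<close> with \<open>k\<close> ones turns the entries \<open>2, 1, \<dots>, 1\<close> into a
  sum over \<open>b\<close>. As \<open>g m (- b) = (- 1) ^ m * g m b\<close>, it suffices to sum over the \<open>b\<close> with the
  parity of \<open>k\<close>. With \<open>a\<close> in the role of the largest summation index, the result is, modulo
  \<open>p\<close>,

  \<open>T(n, 2, 1, \<dots>, 1) = - 4 * (\<Sum> a ^ (- n) * b ^ (- k - 1) * G a b)\<close>,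
  where \<open>G a b = (\<Sum> g m b / m)\<close>,

  the outer sum running over \<open>a\<close> and \<open>b\<close> between \<open>0\<close> and \<open>p\<close> with the parity of \<open>k\<close>, and the
  inner one over the \<open>m\<close> between \<open>0\<close> and \<open>a\<close> with the other parity (lemma
  \<open>parity_sum_double_sum\<close>). If \<open>n + k\<close> is odd, then exchanging \<open>n\<close> with \<open>k + 1\<close> preserves the
  parity condition and amounts to replacing \<open>G a b\<close> by \<open>G b a\<close>.

  The duality therefore rests on a symmetry of \<open>G\<close>. From \<open>m * g m b = b * g b m\<close> and a
  difference equation for \<open>g\<close> it follows that \<open>G a b - G b a\<close> is zero when \<open>a\<close> and \<open>b\<close> are
  even, and of the form \<open>\<phi> a - \<phi> b\<close> when they are odd (lemma
  \<open>mittag_leffler_sum_reciprocity\<close>). In the odd case \<open>n\<close> and \<open>k + 1\<close> are even, so that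
  \<open>\<phi> a\<close> is multiplied by the sum of the \<open>b ^ (- k - 1)\<close> over the odd \<open>b\<close>, which is half of
  the corresponding sum over all nonzero residues and hence zero modulo \<open>p\<close>; the same holds for
  \<open>\<phi> b\<close>. Nothing remains of the asymmetry.

  The other two identities follow from the duality by the reflection \<open>n \<mapsto> p - n\<close>, which reverses
  an index, multiplies the sum by \<open>- 1\<close> to the weight, and exchanges \<open>T\<close> with \<open>S\<close> exactly when
  the depth is odd (lemma \<open>parity_sum_reversal\<close>).
\<close>

section \<open>Smaller numbers of opposite parity\<close>

text \<open>
  The entries of an index tuple alternate in parity, so these are the possible successors of the
  entry \<open>m\<close>. The number \<open>0\<close> is included: it serves as an additional even entry after the last
  one and thereby forces that one to be odd.
\<close>

definition below :: "nat \<Rightarrow> nat set" where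
  "below m = {j. j < m \<and> odd (m + j)}"

lemma finite_below [simp]: "finite (below m)"
  by (simp add: below_def)

lemma below_0 [simp]: "below 0 = {}"
  by (simp add: below_def)

lemma below_1 [simp]: "below (Suc 0) = {0}"
  by (auto simp: below_def)

lemma below_step: "below (Suc (Suc m)) = insert (Suc m) (below m)"
  by (auto simp: below_def less_Suc_eq)

lemma Suc_notin_below: "Suc m \<notin> below m"
  by (simp add: below_def)

lemma sum_below_step:
  "(\<Sum>j\<in>below (Suc (Suc m)). f j) = f (Suc m) + (\<Sum>j\<in>below m. f j :: int)"
  by (simp add: below_step Suc_notin_below)


section \<open>The coefficients of powers of \<open>(1 + t) / (1 - t)\<close>\<close>

text \<open>
  The coefficient of \<open>t ^ m\<close> in \<open>((1 + t) / (1 - t)) ^ b\<close>, that is, the value at \<open>b\<close> of the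
  \<open>m\<close>-th Mittag-Leffler polynomial. The recursion compares coefficients in \<open>(1 - t) * F (b + 1) =
  (1 + t) * F b\<close>, where \<open>F b\<close> is the power with exponent \<open>b\<close>. In this form the values are
  visibly integers, which would be hidden by the polynomials with their denominators.
\<close>

fun mittag_leffler :: "nat \<Rightarrow> nat \<Rightarrow> int" where
  "mittag_leffler 0 b = 1"
| "mittag_leffler (Suc m) 0 = 0"
| "mittag_leffler (Suc m) (Suc b) = mittag_leffler (Suc m) b + mittag_leffler m (Suc b) + mittag_leffler m b"

lemma mittag_leffler_index_1: "mittag_leffler (Suc 0) b = 2 * int b"
  by (induction b) simp_all

lemma mittag_leffler_index_2: "mittag_leffler (Suc (Suc 0)) b = 2 * int b * int b"
  by (induction b) (simp_all add: mittag_leffler_index_1 algebra_simps)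

lemma mittag_leffler_arg_0: "mittag_leffler m 0 = (if m = 0 then 1 else 0)"
  by (cases m) simp_all

lemma mittag_leffler_arg_1: "mittag_leffler m (Suc 0) = (if m = 0 then 1 else 2)"
proof (induction m)
  case (Suc m)
  then show ?case by (cases m) simp_all
qed simp

lemma mittag_leffler_arg_2: "mittag_leffler (Suc m) (Suc (Suc 0)) = 4 * int (Suc m)"
proof (induction m)
  case 0
  show ?case by (simp add: mittag_leffler_index_1)
next
  case (Suc m)
  then show ?case by (simp add: mittag_leffler_arg_1 del: mittag_leffler.simps(3)) (simp add: mittag_leffler_arg_1)
qed

text \<open>
  The recursion is symmetric in the two arguments, so both sides satisfy it, as functions of
  \<open>m\<close> and \<open>b\<close>, and it is enough to compare them for \<open>m = 0\<close> and for \<open>b = 0\<close>.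
\<close>

lemma mittag_leffler_arg_step: "mittag_leffler m (Suc (Suc b)) - mittag_leffler m b = 2 * mittag_leffler (Suc b) m"
proof (induction m b rule: mittag_leffler.induct)
  case (1 b)
  show ?case by (simp add: mittag_leffler_arg_0)
next
  case (2 m)
  show ?case using mittag_leffler_arg_2[of m] by (simp add: mittag_leffler_index_1 del: mittag_leffler.simps(3))
next
  case (3 m b)
  have "mittag_leffler (Suc m) (Suc (Suc (Suc b))) - mittag_leffler (Suc m) (Suc b) =
      (mittag_leffler (Suc m) (Suc (Suc b)) - mittag_leffler (Suc m) b) + (mittag_leffler m (Suc (Suc (Suc b))) - mittag_leffler m (Suc b))
      + (mittag_leffler m (Suc (Suc b)) - mittag_leffler m b)"
    by simp
  also have "\<dots> = 2 * mittag_leffler (Suc b) (Suc m) + 2 * mittag_leffler (Suc (Suc b)) m + 2 * mittag_leffler (Suc b) m"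
    by (simp only: 3)
  also have "\<dots> = 2 * mittag_leffler (Suc (Suc b)) (Suc m)"
    by simp
  finally show ?case .
qed

text \<open>
  These are the coefficients of the differential equation \<open>(1 - t\<^sup>2) * F' = 2 * b * F\<close> satisfied by
  \<open>F = ((1 + t) / (1 - t)) ^ b\<close>.
\<close>

lemma mittag_leffler_index_step:
  "int (Suc (Suc m)) * mittag_leffler (Suc (Suc m)) b - int m * mittag_leffler m b = 2 * int b * mittag_leffler (Suc m) b"
proof (induction m b rule: mittag_leffler.induct)
  case (1 b)
  show ?case by (simp add: mittag_leffler_index_1 mittag_leffler_index_2)
next
  case (2 m)
  show ?case by (simp add: mittag_leffler_arg_0)
next
  case (3 m b)
  note r = mittag_leffler.simps(3)[of "Suc (Suc m)" b] mittag_leffler.simps(3)[of "Suc m" b] mittag_leffler.simps(3)[of m b]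
  show ?case using 3 r by (simp add: algebra_simps del: mittag_leffler.simps)
qed

text \<open>
  Summing the differential equation gives the recursion that the nested sums with all entries
  \<open>1\<close> satisfy as well; this is what identifies those sums as coefficients in \<open>b\<close> of
  \<open>mittag_leffler m b\<close>.
\<close>

lemma mittag_leffler_sum_index: "int m * mittag_leffler m b = 2 * int b * (\<Sum>j\<in>below m. mittag_leffler j b)"
proof (induction m rule: induct_nat_012)
  case (ge2 m)
  then show ?case using mittag_leffler_index_step[of m b]
    by (simp add: sum_below_step algebra_simps del: mittag_leffler.simps)
qed (simp_all add: mittag_leffler_index_1)

lemma mittag_leffler_sum_arg: "m > 0 \<Longrightarrow> mittag_leffler m b = 2 * (\<Sum>j\<in>below b. mittag_leffler j m)"
proof (induction b rule: induct_nat_012)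
  case (ge2 b)
  then show ?case using mittag_leffler_arg_step[of m b]
    by (simp add: sum_below_step algebra_simps del: mittag_leffler.simps)
qed (simp_all add: mittag_leffler_arg_0 mittag_leffler_arg_1 mittag_leffler_index_1)

text \<open>
  The summed equations in the index and in the argument have the same right-hand side up to the
  factor \<open>b\<close>.
\<close>

lemma mittag_leffler_symmetric: "int m * mittag_leffler m b = int b * mittag_leffler b m"
proof (cases "m = 0 \<or> b = 0")
  case True
  then show ?thesis by (auto simp: mittag_leffler_arg_0)
next
  case False
  then have "mittag_leffler b m = 2 * (\<Sum>j\<in>below m. mittag_leffler j b)" by (intro mittag_leffler_sum_arg) auto
  then show ?thesis by (simp add: mittag_leffler_sum_index)
qed


section \<open>Inverses modulo a prime\<close>

definition inv_mod :: "nat \<Rightarrow> nat \<Rightarrow> int" where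
  "inv_mod p m = modular_inverse (int p) (int m)"

lemma inv_mod_0 [simp]: "prime p \<Longrightarrow> inv_mod p 0 = 0"
  by (auto simp: inv_mod_def modular_inverse_def)

lemma inv_mod_right:
  assumes "prime p" "0 < m" "m < p"
  shows "[int m * inv_mod p m = 1] (mod int p)"
proof -
  have "coprime m p" 
    using assms by (metis coprime_commute nat_dvd_not_less prime_imp_coprime_nat)
  then show ?thesis unfolding inv_mod_def by (intro cong_modular_inverse1) simp
qed

lemma inv_mod_cancel:
  assumes "prime p" "0 < m" "m < p" "[int m * x = int m * y] (mod int p)"
  shows "[x = y] (mod int p)"
proof -
  have "coprime (int m) (int p)" 
    using assms by (metis coprime_commute coprime_int_iff nat_dvd_not_less prime_imp_coprime_nat)
  then show ?thesis using assms(4) by (simp add: cong_mult_lcancel)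
qed

lemma inv_mod_eqI:
  assumes "prime p" "0 < m" "m < p" "[int m * x = y] (mod int p)"
  shows "[x = inv_mod p m * y] (mod int p)"
proof -
  have "[int m * (inv_mod p m * y) = 1 * y] (mod int p)"
    using cong_mult[OF inv_mod_right[OF assms(1-3)] cong_refl] by (simp add: mult_ac)
  then have "[int m * x = int m * (inv_mod p m * y)] (mod int p)"
    using assms(4) by (simp add: cong_def)
  then show ?thesis using inv_mod_cancel assms by blast
qed


section \<open>A reciprocity law for weighted partial sums\<close>

lemma mittag_leffler_symmetric_mod:
  assumes "prime p" "0 < m" "m < p" "0 < b" "b < p"
  shows "[inv_mod p m * mittag_leffler b m = inv_mod p b * mittag_leffler m b] (mod int p)"
proof (rule cong_sym, rule inv_mod_eqI[OF assms(1-3)])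
  have "int m * (inv_mod p b * mittag_leffler m b) = int b * inv_mod p b * mittag_leffler b m"
    using mittag_leffler_symmetric[of m b] by (metis mult.assoc mult.commute)
  also have "[\<dots> = 1 * mittag_leffler b m] (mod int p)"
    by (intro cong_mult inv_mod_right cong_refl assms)
  finally show "[int m * (inv_mod p b * mittag_leffler m b) = mittag_leffler b m] (mod int p)" by simp
qed

definition mittag_leffler_sum :: "nat \<Rightarrow> nat \<Rightarrow> nat \<Rightarrow> int" where
  "mittag_leffler_sum p a b = (\<Sum>m\<in>below a. inv_mod p m * mittag_leffler m b)"

text \<open>
  The obstruction to the symmetry of \<open>mittag_leffler_sum\<close> in its two arguments. It comes from the
  index \<open>m = 0\<close>, which lies in \<open>below c\<close> only for odd \<open>c\<close>: it takes part in the summed equation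
  \<open>mittag_leffler_sum_arg\<close>, but is annihilated by the factor \<open>inv_mod p m\<close> in
  \<open>mittag_leffler_sum\<close>.
\<close>

definition defect :: "nat \<Rightarrow> nat \<Rightarrow> int" where
  "defect p c = (if odd c then \<Sum>m\<in>below c. 2 * inv_mod p m else 0)"

text \<open>
  By the symmetry, the factor \<open>inv_mod p m\<close> may be exchanged for the constant \<open>inv_mod p (Suc a)\<close>,
  after which the sum is evaluated by \<open>mittag_leffler_sum_arg\<close>. The correction accounts for \<open>m = 0\<close>,
  where the symmetry fails because \<open>0\<close> has no inverse.
\<close>

lemma mittag_leffler_sum_arg_step:
  assumes p: "prime p" and a: "Suc a < p" and b: "b < p"
  shows "[(\<Sum>m\<in>below b. inv_mod p m * (2 * mittag_leffler (Suc a) m)) =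
          inv_mod p (Suc a) * mittag_leffler (Suc a) b - (if odd b then 2 * inv_mod p (Suc a) else 0)] (mod int p)"
proof -
  have t: "[inv_mod p m * (2 * mittag_leffler (Suc a) m) =
      2 * inv_mod p (Suc a) * mittag_leffler m (Suc a) - (if m = 0 then 2 * inv_mod p (Suc a) else 0)] (mod int p)"
    if "m \<in> below b" for m
  proof (cases "m = 0")
    case True
    then show ?thesis using p by simp
  next
    case False
    then have "[inv_mod p m * mittag_leffler (Suc a) m = inv_mod p (Suc a) * mittag_leffler m (Suc a)] (mod int p)"
      using that a b p by (intro mittag_leffler_symmetric_mod) (auto simp: below_def)
    from cong_mult[OF cong_refl[of 2] this] show ?thesis using False by (simp add: mult_ac)
  qed
  have "[(\<Sum>m\<in>below b. inv_mod p m * (2 * mittag_leffler (Suc a) m)) =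
     (\<Sum>m\<in>below b. 2 * inv_mod p (Suc a) * mittag_leffler m (Suc a) - (if m = 0 then 2 * inv_mod p (Suc a) else 0))] (mod int p)"
    by (intro cong_sum t)
  also have "(\<Sum>m\<in>below b. 2 * inv_mod p (Suc a) * mittag_leffler m (Suc a) - (if m = 0 then 2 * inv_mod p (Suc a) else 0))
     = inv_mod p (Suc a) * (2 * (\<Sum>m\<in>below b. mittag_leffler m (Suc a))) - (if 0 \<in> below b then 2 * inv_mod p (Suc a) else 0)"
    by (simp add: sum_subtractf sum_distrib_left mult_ac)
  also have "2 * (\<Sum>m\<in>below b. mittag_leffler m (Suc a)) = mittag_leffler (Suc a) b"
    by (rule mittag_leffler_sum_arg[symmetric]) simp
  also have "0 \<in> below b \<longleftrightarrow> odd b" by (auto simp: below_def intro: odd_pos)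
  finally show ?thesis .
qed

text \<open>
  Raising \<open>a\<close> by 2 adds one term to \<open>mittag_leffler_sum p a b\<close>, while it changes every term of
  \<open>mittag_leffler_sum p b a\<close>. By \<open>mittag_leffler_sum_arg_step\<close> the total changes agree up to
  a term that depends only on \<open>a\<close>, given its parity, and that term is the increment of the defect.
\<close>

lemma mittag_leffler_sum_reciprocity:
  assumes p: "prime p" and b: "b < p"
  shows "a < p \<Longrightarrow> even (a + b) \<Longrightarrow>
    [mittag_leffler_sum p a b + defect p b = mittag_leffler_sum p b a + defect p a] (mod int p)"
proof (induction a rule: induct_nat_012)
  case 0
  have "(\<Sum>m\<in>below b. inv_mod p m * mittag_leffler m 0) = 0"
    using p by (intro sum.neutral) (auto simp: mittag_leffler_arg_0)
  then show ?case using 0 by (simp add: mittag_leffler_sum_def defect_def)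
next
  case 1
  have "(\<Sum>m\<in>below b. inv_mod p m * mittag_leffler m (Suc 0)) = (\<Sum>m\<in>below b. 2 * inv_mod p m)"
    using p by (intro sum.cong) (auto simp: mittag_leffler_arg_1)
  then show ?case using 1 p by (simp add: mittag_leffler_sum_def defect_def)
next
  case (ge2 a)
  let ?d = "if odd b then 2 * inv_mod p (Suc a) else 0"
  have IH: "[mittag_leffler_sum p a b + defect p b = mittag_leffler_sum p b a + defect p a] (mod int p)"
    using ge2 by auto
  have "mittag_leffler_sum p b (Suc (Suc a)) = mittag_leffler_sum p b a + (\<Sum>m\<in>below b. inv_mod p m * (2 * mittag_leffler (Suc a) m))"
    unfolding mittag_leffler_sum_def mittag_leffler_arg_step[symmetric] by (simp add: algebra_simps sum_subtractf)
  moreover have "mittag_leffler_sum p (Suc (Suc a)) b = mittag_leffler_sum p a b + inv_mod p (Suc a) * mittag_leffler (Suc a) b"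
    by (simp add: mittag_leffler_sum_def sum_below_step)
  moreover have "defect p (Suc (Suc a)) = defect p a + ?d"
    using ge2.prems by (auto simp: defect_def sum_below_step)
  moreover note cong_add[OF IH mittag_leffler_sum_arg_step[OF p _ b, of a, THEN cong_sym]]
  ultimately show ?case
    using ge2.prems by (simp add: cong_iff_dvd_diff algebra_simps)
qed


section \<open>Power sums modulo a prime\<close>

text \<open>
  Multiplication by a primitive root \<open>r\<close> permutes the nonzero residues, so the sum is fixed by
  multiplication with \<open>r ^ e\<close>, which differs from 1.
\<close>

lemma power_sum_mod_prime:
  assumes p: "prime p" and e: "\<not> (p - 1) dvd e"
  shows "[(\<Sum>b\<in>{0<..<p}. int b ^ e) = 0] (mod int p)"
proof -
  from p obtain r where r: "residue_primroot p r"
    using prime_primitive_root_exists[of p] prime_gt_1_nat[of p] by auto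
  then have cop: "coprime p r" and ord: "ord p r = p - 1"
    using p by (auto simp: residue_primroot_def totient_prime)
  have "\<not> [r ^ e = 1] (mod p)"
    using e ord ord_divides[of r e p] by simp
  then have ne: "\<not> int p dvd int r ^ e - 1"
    by (metis cong_iff_dvd_diff cong_int_iff of_nat_1 of_nat_power)
  define S where "S = (\<Sum>x\<in>{1..<int p}. x ^ e)"
  have "S = (\<Sum>x\<in>{1..<int p}. (int r * x mod int p) ^ e)"
    unfolding S_def
    by (rule sum.reindex_bij_betw[symmetric], rule bij_betw_int_remainders_mult)
      (use cop in \<open>simp add: coprime_commute\<close>)
  also have "[\<dots> = (\<Sum>x\<in>{1..<int p}. (int r * x) ^ e)] (mod int p)"
    by (intro cong_sum cong_pow) simp
  also have "(\<Sum>x\<in>{1..<int p}. (int r * x) ^ e) = int r ^ e * S"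
    by (simp add: S_def power_mult_distrib sum_distrib_left)
  finally have "int p dvd S * (int r ^ e - 1)"
    by (simp add: cong_iff_dvd_diff algebra_simps dvd_diff_commute)
  with ne p have "int p dvd S"
    by (simp add: prime_dvd_mult_iff)
  moreover have "S = (\<Sum>b\<in>{0<..<p}. int b ^ e)"
    unfolding S_def by (rule sum.reindex_bij_witness[of _ int nat]) auto
  ultimately show ?thesis by (simp add: cong_0_iff)
qed

lemma inv_mod_power:
  assumes p: "prime p" and b: "0 < b" "b < p" and q: "q \<le> p - 1"
  shows "[inv_mod p b ^ q = int b ^ (p - 1 - q)] (mod int p)"
proof -
  have "[b ^ (p - 1) = 1] (mod p)"
    using b by (intro fermat_theorem[OF p]) (auto dest: dvd_imp_le)
  then have fermat: "[int b ^ (p - 1) = 1] (mod int p)"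
    by (metis cong_int_iff of_nat_1 of_nat_power)
  have "[inv_mod p b ^ q * 1 = inv_mod p b ^ q * int b ^ (p - 1)] (mod int p)"
    by (intro cong_mult cong_refl cong_sym[OF fermat])
  also have "int b ^ (p - 1) = int b ^ q * int b ^ (p - 1 - q)"
    using q by (metis le_add_diff_inverse power_add)
  also have "inv_mod p b ^ q * (int b ^ q * int b ^ (p - 1 - q)) =
      (int b * inv_mod p b) ^ q * int b ^ (p - 1 - q)"
    by (simp add: power_mult_distrib)
  also have "[\<dots> = 1 ^ q * int b ^ (p - 1 - q)] (mod int p)"
    by (intro cong_mult cong_pow cong_refl inv_mod_right assms)
  finally show ?thesis by simp
qed

text \<open>
  The exponents \<open>0\<close> and \<open>p - 1\<close> are excluded for \<open>q\<close>, since \<open>b ^ 0\<close> and \<open>b ^ (p - 1)\<close> agree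
  modulo \<open>p\<close> on the nonzero residues and cannot be told apart by such sums.
\<close>

lemma power_orthogonality:
  assumes p: "prime p" and q: "0 < q" "q < p - 1" and l: "l < p"
  shows "[(\<Sum>b\<in>{0<..<p}. inv_mod p b ^ q * int b ^ l) = (if l = q then -1 else 0)] (mod int p)"
proof (cases "l = q")
  case True
  have "[(\<Sum>b\<in>{0<..<p}. inv_mod p b ^ q * int b ^ l) = (\<Sum>b\<in>{0<..<p}. 1)] (mod int p)"
  proof (rule cong_sum)
    fix b assume "b \<in> {0<..<p}"
    then have "[(int b * inv_mod p b) ^ q = 1 ^ q] (mod int p)"
      by (intro cong_pow inv_mod_right p) auto
    then show "[inv_mod p b ^ q * int b ^ l = 1] (mod int p)"
      using True by (simp add: power_mult_distrib mult.commute)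
  qed
  also have "(\<Sum>b\<in>{0<..<p}. 1) = int p - 1"
    using p prime_gt_0_nat[OF p] by (simp add: of_nat_diff)
  also have "[int p - 1 = -1] (mod int p)" by (simp add: cong_iff_dvd_diff)
  finally show ?thesis using True by simp
next
  case False
  \<comment> \<open>The exponent lies strictly between \<open>0\<close> and \<open>2 * (p - 1)\<close>, and it equals \<open>p - 1\<close> only for \<open>l = q\<close>.\<close>
  have "\<not> (p - 1) dvd (p - 1 - q + l)"
  proof
    assume "(p - 1) dvd (p - 1 - q + l)"
    then obtain c where c: "p - 1 - q + l = (p - 1) * c" by blast
    have "(p - 1) * c < (p - 1) * 2" "(p - 1) * c > 0"
      using q l unfolding c[symmetric] by auto
    then have "c = 1" by auto
    with c q False show False by auto
  qed
  note z = power_sum_mod_prime[OF p this]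
  have "[(\<Sum>b\<in>{0<..<p}. inv_mod p b ^ q * int b ^ l) =
      (\<Sum>b\<in>{0<..<p}. int b ^ (p - 1 - q) * int b ^ l)] (mod int p)"
    using q by (intro cong_sum cong_mult cong_refl inv_mod_power p) auto
  also have "(\<Sum>b\<in>{0<..<p}. int b ^ (p - 1 - q) * int b ^ l) = (\<Sum>b\<in>{0<..<p}. int b ^ (p - 1 - q + l))"
    by (simp add: power_add)
  also note z
  finally show ?thesis using False by simp
qed

lemma inv_mod_reflect:
  assumes p: "prime p" and b: "0 < b" "b < p"
  shows "[inv_mod p (p - b) = - inv_mod p b] (mod int p)"
proof -
  have "[int b * inv_mod p b - int p * inv_mod p b = 1 - 0] (mod int p)"
    by (intro cong_diff inv_mod_right assms) (simp add: cong_0_iff)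
  then have "[int (p - b) * (- inv_mod p b) = 1] (mod int p)"
    using b by (simp add: of_nat_diff algebra_simps)
  from inv_mod_eqI[OF p _ _ this] show ?thesis
    using b by (simp add: cong_sym)
qed


section \<open>Nested sums with a prescribed largest entry\<close>

text \<open>
  The part of the sum \<open>T\<close> with index \<open>s\<close> in which the largest entry \<open>n\<^sub>1\<close> equals \<open>m\<close>. The empty
  index is assigned to \<open>m = 0\<close>, so that the last entry of a nonempty index has to be odd.
\<close>

fun alt_sum :: "nat \<Rightarrow> nat list \<Rightarrow> nat \<Rightarrow> int" where
  "alt_sum p [] m = (if m = 0 then 1 else 0)"
| "alt_sum p (s # ss) m = 2 * inv_mod p m ^ s * (\<Sum>j\<in>below m. alt_sum p ss j)"

lemma alt_sum_parity: "odd (m + length s) \<Longrightarrow> alt_sum p s m = 0"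
proof (induction s arbitrary: m)
  case (Cons a s)
  have "(\<Sum>j\<in>below m. alt_sum p s j) = 0"
    using Cons.prems by (intro sum.neutral ballI Cons.IH) (auto simp: below_def)
  then show ?case by simp
qed (auto intro: odd_pos)

lemma alt_sum_short: "m < length s \<Longrightarrow> alt_sum p s m = 0"
proof (induction s arbitrary: m)
  case (Cons a s)
  have "(\<Sum>j\<in>below m. alt_sum p s j) = 0"
    using Cons.prems by (intro sum.neutral ballI Cons.IH) (auto simp: below_def)
  then show ?case by simp
qed simp

text \<open>
  Both sides satisfy the recursion \<open>mittag_leffler_sum_index\<close> in \<open>m\<close>, in which \<open>m\<close> can be inverted.
  The factor \<open>b\<close> in that recursion raises the number of entries \<open>1\<close> by one. By \<open>alt_sum_short\<close>,
  the expansion may be cut off at \<open>p\<close> without loss.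
\<close>

lemma mittag_leffler_expansion:
  assumes p: "prime p"
  shows "m < p \<Longrightarrow> [mittag_leffler m b = (\<Sum>l<p. alt_sum p (replicate l 1) m * int b ^ l)] (mod int p)"
proof (induction m rule: less_induct)
  case (less m)
  let ?c = "\<lambda>m l. alt_sum p (replicate l 1) m"
  show ?case
  proof (cases "m = 0")
    case True
    have "(\<Sum>l<p. ?c 0 l * int b ^ l) = (\<Sum>l<p. if l = 0 then 1 else 0)"
      by (intro sum.cong refl) (simp add: gr0_conv_Suc split: if_splits, auto simp: gr0_conv_Suc)
    then show ?thesis using True less.prems by simp
  next
    case False
    have "[2 * int b * (\<Sum>j\<in>below m. mittag_leffler j b) =
        2 * int b * (\<Sum>j\<in>below m. \<Sum>l<p. ?c j l * int b ^ l)] (mod int p)"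
      using less by (intro cong_mult cong_refl cong_sum) (auto simp: below_def)
    then have "[int m * mittag_leffler m b = 2 * int b * (\<Sum>j\<in>below m. \<Sum>l<p. ?c j l * int b ^ l)] (mod int p)"
      by (simp add: mittag_leffler_sum_index)
    then have "[mittag_leffler m b = inv_mod p m * (2 * int b * (\<Sum>j\<in>below m. \<Sum>l<p. ?c j l * int b ^ l))] (mod int p)"
      using False less.prems p by (intro inv_mod_eqI) auto
    also have "inv_mod p m * (2 * int b * (\<Sum>j\<in>below m. \<Sum>l<p. ?c j l * int b ^ l)) =
        (\<Sum>l<p. ?c m (Suc l) * int b ^ Suc l)"
      by (subst sum.swap) (simp add: sum_distrib_left sum_distrib_right mult_ac)
    also have "\<dots> = (\<Sum>l<Suc p. ?c m l * int b ^ l)"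
      using False by (subst sum.lessThan_Suc_shift) simp
    also have "\<dots> = (\<Sum>l<p. ?c m l * int b ^ l)"
      using less.prems by (simp add: alt_sum_short)
    finally show ?thesis .
  qed
qed

text \<open>
  A polynomial of degree less than \<open>p\<close> is determined by its values modulo \<open>p\<close>: the orthogonality
  of the powers extracts the coefficient of \<open>b ^ q\<close>.
\<close>

lemma alt_sum_ones_eq_mittag_leffler_transform:
  assumes p: "prime p" and q: "0 < q" "q < p - 1" and m: "m < p"
  shows "[alt_sum p (replicate q 1) m = - (\<Sum>b\<in>{0<..<p}. inv_mod p b ^ q * mittag_leffler m b)] (mod int p)"
proof -
  let ?c = "\<lambda>l. alt_sum p (replicate l 1) m"
  have "[(\<Sum>b\<in>{0<..<p}. inv_mod p b ^ q * mittag_leffler m b) =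
      (\<Sum>b\<in>{0<..<p}. inv_mod p b ^ q * (\<Sum>l<p. ?c l * int b ^ l))] (mod int p)"
    by (intro cong_sum cong_mult cong_refl mittag_leffler_expansion p m)
  also have "(\<Sum>b\<in>{0<..<p}. inv_mod p b ^ q * (\<Sum>l<p. ?c l * int b ^ l)) =
      (\<Sum>l<p. ?c l * (\<Sum>b\<in>{0<..<p}. inv_mod p b ^ q * int b ^ l))"
    unfolding sum_distrib_left by (subst sum.swap) (simp add: mult_ac)
  also have "[\<dots> = (\<Sum>l<p. ?c l * (if l = q then -1 else 0))] (mod int p)"
    by (intro cong_sum cong_mult cong_refl power_orthogonality p q) auto
  also have "(\<Sum>l<p. ?c l * (if l = q then -1 else 0)) = - ?c q"
    using q by (simp add: if_distrib sum.delta cong: if_cong)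
  finally have "[- (\<Sum>b\<in>{0<..<p}. inv_mod p b ^ q * mittag_leffler m b) = - (- ?c q)] (mod int p)"
    by (simp only: cong_minus_minus_iff)
  then show ?thesis by (simp add: cong_sym)
qed

text \<open>
  The function \<open>(1 + t) / (1 - t)\<close> is inverted by \<open>t \<mapsto> - t\<close>. In terms of the expansion, the only
  powers of \<open>b\<close> that occur are those whose exponent has the parity of \<open>m\<close>.
\<close>

lemma mittag_leffler_reflect:
  assumes p: "prime p" and m: "m < p" and b: "b \<le> p"
  shows "[mittag_leffler m (p - b) = (-1) ^ m * mittag_leffler m b] (mod int p)"
proof -
  let ?c = "\<lambda>l. alt_sum p (replicate l 1) m"
  have "[mittag_leffler m (p - b) = (\<Sum>l<p. ?c l * int (p - b) ^ l)] (mod int p)"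
    by (intro mittag_leffler_expansion p m)
  also have "[(\<Sum>l<p. ?c l * int (p - b) ^ l) = (\<Sum>l<p. (-1) ^ m * (?c l * int b ^ l))] (mod int p)"
  proof (rule cong_sum)
    fix l
    show "[?c l * int (p - b) ^ l = (-1) ^ m * (?c l * int b ^ l)] (mod int p)"
    proof (cases "odd (m + l)")
      case False
      have "[int (p - b) = - int b] (mod int p)"
        using b by (simp add: cong_iff_dvd_diff of_nat_diff)
      then have "[?c l * int (p - b) ^ l = ?c l * (- int b) ^ l] (mod int p)"
        by (intro cong_mult cong_refl cong_pow)
      also have "(- int b) ^ l = (-1) ^ m * int b ^ l"
        using False by (cases "even l") auto
      finally show ?thesis by (simp add: mult_ac)
    qed (simp add: alt_sum_parity)
  qed
  also have "(\<Sum>l<p. (-1) ^ m * (?c l * int b ^ l)) = (-1) ^ m * (\<Sum>l<p. ?c l * int b ^ l)"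
    by (simp add: sum_distrib_left)
  also have "[\<dots> = (-1) ^ m * mittag_leffler m b] (mod int p)"
    by (intro cong_mult cong_refl cong_sym[OF mittag_leffler_expansion] p m)
  finally show ?thesis .
qed


section \<open>Sums over residues of one parity\<close>

definition parity_class :: "nat \<Rightarrow> nat \<Rightarrow> nat set" where
  "parity_class p k = {b. 0 < b \<and> b < p \<and> even (b + k)}"

lemma finite_parity_class [simp]: "finite (parity_class p k)"
  by (simp add: parity_class_def)

text \<open>
  As \<open>p\<close> is odd, the reflection \<open>b \<mapsto> p - b\<close> exchanges the two parity classes.
\<close>

lemma sum_even_function:
  fixes f :: "nat \<Rightarrow> int"
  assumes p: "odd p" and f: "\<And>b. 0 < b \<Longrightarrow> b < p \<Longrightarrow> [f (p - b) = f b] (mod int p)"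
  shows "[(\<Sum>b\<in>{0<..<p}. f b) = 2 * (\<Sum>b\<in>parity_class p k. f b)] (mod int p)"
proof -
  have "{0<..<p} = parity_class p k \<union> parity_class p (Suc k)"
    and "parity_class p k \<inter> parity_class p (Suc k) = {}"
    by (auto simp: parity_class_def)
  then have "(\<Sum>b\<in>{0<..<p}. f b) = (\<Sum>b\<in>parity_class p k. f b) + (\<Sum>b\<in>parity_class p (Suc k). f b)"
    by (simp add: sum.union_disjoint)
  also have "(\<Sum>b\<in>parity_class p (Suc k). f b) = (\<Sum>b\<in>parity_class p k. f (p - b))"
    by (rule sum.reindex_bij_witness[of _ "\<lambda>b. p - b" "\<lambda>b. p - b"])
      (use p in \<open>auto simp: parity_class_def\<close>)
  also have "[(\<Sum>b\<in>parity_class p k. f b) + (\<Sum>b\<in>parity_class p k. f (p - b)) =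
      (\<Sum>b\<in>parity_class p k. f b) + (\<Sum>b\<in>parity_class p k. f b)] (mod int p)"
    by (intro cong_add cong_refl cong_sum f) (auto simp: parity_class_def)
  finally show ?thesis by simp
qed

lemma even_power_sum_parity_class:
  assumes p: "prime p" and q: "0 < q" "q < p - 1" "even q"
  shows "[(\<Sum>b\<in>parity_class p k. inv_mod p b ^ q) = 0] (mod int p)"
proof -
  have odd: "odd p" using p q by (intro prime_odd_nat) auto
  have "[inv_mod p (p - b) ^ q = inv_mod p b ^ q] (mod int p)" if "0 < b" "b < p" for b
    using cong_pow[OF inv_mod_reflect[OF p that], of q] q by simp
  note cong_sym[OF sum_even_function[where f = "\<lambda>b. inv_mod p b ^ q" and k = k, OF odd this]]
  also have "[(\<Sum>b\<in>{0<..<p}. inv_mod p b ^ q) = 0] (mod int p)"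
    using power_orthogonality[OF p q(1,2), of 0] q by simp
  finally have "int p dvd 2 * (\<Sum>b\<in>parity_class p k. inv_mod p b ^ q)"
    by (simp add: cong_0_iff)
  moreover have "coprime (int p) 2" using odd by simp
  ultimately show ?thesis by (simp add: cong_0_iff coprime_dvd_mult_right_iff)
qed


section \<open>The double sum\<close>

text \<open>
  All indices \<open>m\<close> occurring in \<open>mittag_leffler_sum p a b\<close> have the parity of \<open>k + 1\<close>, so the sign
  of the reflected sum cancels that of the inverse power.
\<close>

lemma mittag_leffler_sum_reflect:
  assumes p: "prime p" and a: "a < p" and b: "0 < b" "b < p" and k: "even (a + k)"
  shows "[inv_mod p (p - b) ^ Suc k * mittag_leffler_sum p a (p - b) = inv_mod p b ^ Suc k * mittag_leffler_sum p a b] (mod int p)"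
proof -
  have "[mittag_leffler_sum p a (p - b) = (\<Sum>m\<in>below a. inv_mod p m * ((-1) ^ Suc k * mittag_leffler m b))] (mod int p)"
    unfolding mittag_leffler_sum_def
  proof (intro cong_sum cong_mult cong_refl)
    fix m assume m: "m \<in> below a"
    then have "(-1) ^ m = ((-1) ^ Suc k :: int)"
      using k by (cases "even m") (auto simp: below_def)
    then show "[mittag_leffler m (p - b) = (-1) ^ Suc k * mittag_leffler m b] (mod int p)"
      using mittag_leffler_reflect[OF p, of m b] m a b by (simp add: below_def)
  qed
  also have "(\<Sum>m\<in>below a. inv_mod p m * ((-1) ^ Suc k * mittag_leffler m b)) = (-1) ^ Suc k * mittag_leffler_sum p a b"
    by (simp add: mittag_leffler_sum_def sum_distrib_left mult_ac)
  finally have "[inv_mod p (p - b) ^ Suc k * mittag_leffler_sum p a (p - b) =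
      (- inv_mod p b) ^ Suc k * ((-1) ^ Suc k * mittag_leffler_sum p a b)] (mod int p)"
    by (intro cong_mult cong_pow inv_mod_reflect p b)
  also have "(- inv_mod p b) ^ Suc k * ((-1) ^ Suc k * mittag_leffler_sum p a b) = inv_mod p b ^ Suc k * mittag_leffler_sum p a b"
    by (simp only: mult.assoc[symmetric] power_mult_distrib[symmetric]) simp
  finally show ?thesis .
qed

text \<open>
  The entry \<open>2\<close> splits into a factor \<open>inv_mod p m\<close> and an entry \<open>1\<close> that joins the \<open>k\<close> others; the
  resulting \<open>k + 1\<close> entries \<open>1\<close> are replaced by their transform.
\<close>

lemma alt_sum_two_ones:
  assumes p: "prime p" and k: "Suc k < p - 1" and a: "a < p" "even (a + k)"
  shows "[alt_sum p ([n, 2] @ replicate k 1) a =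
    - 4 * (\<Sum>b\<in>parity_class p k. inv_mod p a ^ n * inv_mod p b ^ Suc k * mittag_leffler_sum p a b)] (mod int p)"
proof -
  have "alt_sum p ([n, 2] @ replicate k 1) a =
      2 * inv_mod p a ^ n * (\<Sum>m\<in>below a. inv_mod p m * alt_sum p (replicate (Suc k) 1) m)"
    by (simp add: power2_eq_square mult_ac)
  also have "[\<dots> = 2 * inv_mod p a ^ n * (\<Sum>m\<in>below a. inv_mod p m *
      - (\<Sum>b\<in>{0<..<p}. inv_mod p b ^ Suc k * mittag_leffler m b))] (mod int p)"
    using k a by (intro cong_mult cong_refl cong_sum alt_sum_ones_eq_mittag_leffler_transform p) (auto simp: below_def)
  also have "(\<Sum>m\<in>below a. inv_mod p m * - (\<Sum>b\<in>{0<..<p}. inv_mod p b ^ Suc k * mittag_leffler m b)) =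
      - (\<Sum>b\<in>{0<..<p}. inv_mod p b ^ Suc k * mittag_leffler_sum p a b)"
    unfolding mittag_leffler_sum_def sum_distrib_left sum_negf[symmetric] mult_minus_right
    by (subst sum.swap) (simp add: mult_ac)
  also have "[2 * inv_mod p a ^ n * - (\<Sum>b\<in>{0<..<p}. inv_mod p b ^ Suc k * mittag_leffler_sum p a b) =
      2 * inv_mod p a ^ n * - (2 * (\<Sum>b\<in>parity_class p k. inv_mod p b ^ Suc k * mittag_leffler_sum p a b))] (mod int p)"
  proof (intro cong_mult cong_refl)
    have "odd p" using p k by (intro prime_odd_nat) auto
    then show "[- (\<Sum>b\<in>{0<..<p}. inv_mod p b ^ Suc k * mittag_leffler_sum p a b) =
        - (2 * (\<Sum>b\<in>parity_class p k. inv_mod p b ^ Suc k * mittag_leffler_sum p a b))] (mod int p)"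
      unfolding cong_minus_minus_iff by (intro sum_even_function mittag_leffler_sum_reflect p a)
  qed
  also have "2 * inv_mod p a ^ n * - (2 * (\<Sum>b\<in>parity_class p k. inv_mod p b ^ Suc k * mittag_leffler_sum p a b)) =
      - 4 * (\<Sum>b\<in>parity_class p k. inv_mod p a ^ n * inv_mod p b ^ Suc k * mittag_leffler_sum p a b)"
    by (simp add: sum_distrib_left sum_negf mult_ac)
  finally show ?thesis .
qed


section \<open>Index tuples\<close>

lemma index_tuples_iff:
  "ns \<in> index_tuples e d N \<longleftrightarrow>
    length ns = d \<and> sorted_wrt (>) ns \<and> set ns \<subseteq> {0<..<N} \<and> (\<forall>j<d. odd (ns ! j + j + d + e))"
proof -
  have "(\<forall>j\<in>{1..d}. [ns ! (j - 1) = d - j + e] (mod 2)) \<longleftrightarrow> (\<forall>j\<in>{..<d}. [ns ! j = d - Suc j + e] (mod 2))"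
  proof -
    have "{1..d} = Suc ` {..<d}" by (simp add: image_Suc_lessThan)
    then show ?thesis by (simp only: ball_simps diff_Suc_1)
  qed
  also have "\<dots> \<longleftrightarrow> (\<forall>j<d. odd (ns ! j + j + d + e))"
  proof -
    have "[ns ! j = d - Suc j + e] (mod 2) \<longleftrightarrow> odd (ns ! j + j + d + e)" if "j < d" for j
      using that by (auto simp: cong_def even_iff_mod_2_eq_zero[symmetric] mod2_eq_if)
    then show ?thesis by auto
  qed
  finally show ?thesis unfolding index_tuples_def by blast
qed

lemma finite_index_tuples [simp]: "finite (index_tuples e d N)"
proof (rule finite_subset)
  show "index_tuples e d N \<subseteq> {ns. set ns \<subseteq> {0<..<N} \<and> length ns = d}"
    by (rule subsetI) (simp add: index_tuples_iff)
  show "finite {ns. set ns \<subseteq> {0<..<N} \<and> length ns = d}"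
    by (intro finite_lists_length_eq) simp
qed

text \<open>
  The positivity of \<open>m\<close> is implied by the right-hand side: if \<open>m = 0\<close>, then the tail can only be
  empty, so that \<open>d = 0\<close> and \<open>m + d\<close> is even.
\<close>

lemma Cons_in_index_tuples:
  "m # ns \<in> index_tuples 1 (Suc d) N \<longleftrightarrow> m < N \<and> odd (m + d) \<and> ns \<in> index_tuples 1 d m"
proof -
  have "(\<forall>j<Suc d. odd ((m # ns) ! j + j + Suc d + 1)) \<longleftrightarrow>
      odd (m + d) \<and> (\<forall>j<d. odd (ns ! j + j + d + 1))"
    unfolding All_less_Suc2 by simp
  moreover have "m > 0" if "length ns = d" "set ns \<subseteq> {0<..<m}" "odd (m + d)"
    using that by (cases ns) (auto intro: odd_pos)
  moreover have "set ns \<subseteq> {0<..<N}" if "set ns \<subseteq> {0<..<m}" "m < N"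
    using that by auto
  ultimately show ?thesis
    unfolding index_tuples_iff by auto
qed

definition tuple_term :: "nat \<Rightarrow> nat list \<Rightarrow> nat list \<Rightarrow> int" where
  "tuple_term p s ns = (\<Prod>j<length s. inv_mod p (ns ! j) ^ (s ! j))"

lemma tuple_term_Cons: "tuple_term p (a # s) (m # ns) = inv_mod p m ^ a * tuple_term p s ns"
  by (simp add: tuple_term_def prod.lessThan_Suc_shift del: prod.lessThan_Suc)

lemma parity_sum_eq_tuple_sum:
  "parity_sum e s p = (\<Sum>ns\<in>index_tuples e (length s) p. 2 ^ length s * tuple_term p s ns)"
  unfolding parity_sum_def tuple_term_def inv_mod_def
  by (simp add: prod.atLeast1_atMost_eq)

text \<open>
  The bound \<open>N\<close> is kept apart from the prime \<open>p\<close>, because the tail of a tuple is bounded by its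
  first entry while the inverses are still taken modulo \<open>p\<close>. For \<open>N = 0\<close> the empty tuple exists,
  but \<open>alt_sum\<close> attaches it to \<open>m = 0\<close>, which is then out of range; hence the extra term.
\<close>

lemma tuple_sum_eq_alt_sum:
  "(\<Sum>ns\<in>index_tuples 1 (length s) N. 2 ^ length s * tuple_term p s ns) =
   (\<Sum>m<N. alt_sum p s m) + (if s = [] \<and> N = 0 then 1 else 0)"
proof (induction s arbitrary: N)
  case Nil
  have "index_tuples 1 0 N = {[]}" by (auto simp: index_tuples_iff)
  then show ?case by (simp add: tuple_term_def)
next
  case (Cons a s)
  let ?d = "length s"
  let ?M = "{m. m < N \<and> odd (m + ?d)}"
  have inner: "2 * inv_mod p m ^ a * (\<Sum>ns\<in>index_tuples 1 ?d m. 2 ^ ?d * tuple_term p s ns) = alt_sum p (a # s) m"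
    if m: "m \<in> ?M" for m
  proof -
    have "(\<Sum>ns\<in>index_tuples 1 ?d m. 2 ^ ?d * tuple_term p s ns) = (\<Sum>j<m. alt_sum p s j)"
      using m by (subst Cons.IH) auto
    also have "\<dots> = (\<Sum>j\<in>below m. alt_sum p s j)"
      using m by (intro sum.mono_neutral_right) (auto simp: below_def intro!: alt_sum_parity)
    finally show ?thesis by simp
  qed
  have "(\<Sum>ns\<in>index_tuples 1 (length (a # s)) N. 2 ^ length (a # s) * tuple_term p (a # s) ns) =
      (\<Sum>(m, ns)\<in>(SIGMA m:?M. index_tuples 1 ?d m). 2 * inv_mod p m ^ a * (2 ^ ?d * tuple_term p s ns))"
  proof (rule sum.reindex_bij_witness[of _ "\<lambda>(m, ns). m # ns" "\<lambda>xs. (hd xs, tl xs)"])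
    fix xs assume xs: "xs \<in> index_tuples 1 (length (a # s)) N"
    then obtain m ns where eq: "xs = m # ns" by (cases xs) (auto simp: index_tuples_iff)
    with xs have "m # ns \<in> index_tuples 1 (Suc ?d) N" by simp
    then show "(hd xs, tl xs) \<in> (SIGMA m:?M. index_tuples 1 ?d m)"
      unfolding Cons_in_index_tuples eq by simp
    show "(case (hd xs, tl xs) of (m, ns) \<Rightarrow> m # ns) = xs" by (simp add: eq)
    show "(case (hd xs, tl xs) of (m, ns) \<Rightarrow> 2 * inv_mod p m ^ a * (2 ^ ?d * tuple_term p s ns)) =
        2 ^ length (a # s) * tuple_term p (a # s) xs"
      by (simp add: eq tuple_term_Cons)
  next
    fix x assume "x \<in> (SIGMA m:?M. index_tuples 1 ?d m)"
    then show "(case x of (m, ns) \<Rightarrow> m # ns) \<in> index_tuples 1 (length (a # s)) N"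
      and "(hd (case x of (m, ns) \<Rightarrow> m # ns), tl (case x of (m, ns) \<Rightarrow> m # ns)) = x"
      using Cons_in_index_tuples[of "fst x" "snd x" ?d N] by (auto split: prod.splits)
  qed
  also have "\<dots> = (\<Sum>m\<in>?M. 2 * inv_mod p m ^ a * (\<Sum>ns\<in>index_tuples 1 ?d m. 2 ^ ?d * tuple_term p s ns))"
    by (subst sum.Sigma[symmetric]) (auto simp: sum_distrib_left)
  also have "\<dots> = (\<Sum>m\<in>?M. alt_sum p (a # s) m)"
    by (intro sum.cong refl inner)
  also have "\<dots> = (\<Sum>m<N. alt_sum p (a # s) m)"
    by (intro sum.mono_neutral_left ballI alt_sum_parity) auto
  finally show ?case by simp
qed

lemma parity_sum_eq_alt_sum:
  "p > 0 \<Longrightarrow> parity_sum 1 s p = (\<Sum>m<p. alt_sum p s m)"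
  by (simp add: parity_sum_eq_tuple_sum tuple_sum_eq_alt_sum[unfolded One_nat_def])


section \<open>Reversal of an index\<close>

lemma rev_in_index_tuples:
  assumes p: "odd p" and e: "even (d + e + e')" and ns: "ns \<in> index_tuples e d p"
  shows "rev (map (\<lambda>x. p - x) ns) \<in> index_tuples e' d p"
proof -
  have len: "length ns = d" and srt: "sorted_wrt (>) ns" and st: "set ns \<subseteq> {0<..<p}"
    and par: "\<And>j. j < d \<Longrightarrow> odd (ns ! j + j + d + e)"
    using ns by (auto simp: index_tuples_iff)
  have "sorted_wrt (\<lambda>x y. p - y > p - x) ns"
    by (rule sorted_wrt_mono_rel[OF _ srt]) (use st in auto)
  then have "sorted_wrt (>) (rev (map (\<lambda>x. p - x) ns))"
    by (simp add: sorted_wrt_rev sorted_wrt_map)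
  moreover have "odd (rev (map (\<lambda>x. p - x) ns) ! j + j + d + e')" if j: "j < d" for j
  proof -
    have "ns ! (d - Suc j) < p" using st len j by (auto simp: subset_iff)
    then have "even (p - ns ! (d - Suc j)) \<longleftrightarrow> odd (ns ! (d - Suc j))"
      using p by simp
    moreover have "odd (ns ! (d - Suc j) + (d - Suc j) + d + e)" using j by (intro par) simp
    moreover have "even (d - Suc j) \<longleftrightarrow> odd (d + j)" using j by auto
    ultimately show ?thesis using e j len by (auto simp: rev_nth)
  qed
  ultimately show ?thesis
    using len st by (auto simp: index_tuples_iff)
qed

lemma tuple_term_reflect:
  assumes p: "prime p" and ns: "length ns = length s" "set ns \<subseteq> {0<..<p}"
  shows "[tuple_term p (rev s) (rev (map (\<lambda>x. p - x) ns)) =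
    (-1) ^ sum_list s * tuple_term p s ns] (mod int p)"
proof -
  let ?d = "length s"
  have "tuple_term p (rev s) (rev (map (\<lambda>x. p - x) ns)) =
      (\<Prod>j<?d. inv_mod p (p - ns ! (?d - Suc j)) ^ (s ! (?d - Suc j)))"
    unfolding tuple_term_def using ns by (intro prod.cong) (auto simp: rev_nth)
  also have "\<dots> = (\<Prod>j<?d. inv_mod p (p - ns ! j) ^ (s ! j))"
    by (rule prod.nat_diff_reindex)
  also have "[\<dots> = (\<Prod>j<?d. (- inv_mod p (ns ! j)) ^ (s ! j))] (mod int p)"
  proof (intro cong_prod cong_pow inv_mod_reflect p)
    fix j assume "j \<in> {..<?d}"
    then have "ns ! j \<in> {0<..<p}" using ns by (metis lessThan_iff nth_mem subsetD)
    then show "0 < ns ! j" "ns ! j < p" by auto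
  qed
  also have "(\<Prod>j<?d. (- inv_mod p (ns ! j)) ^ (s ! j)) =
      (\<Prod>j<?d. (-1) ^ (s ! j) * inv_mod p (ns ! j) ^ (s ! j))"
    by (intro prod.cong refl) (metis mult_minus1 power_mult_distrib)
  also have "\<dots> = (-1) ^ sum_list s * tuple_term p s ns"
    by (simp add: prod.distrib tuple_term_def sum_list_sum_nth power_sum atLeast0LessThan)
  finally show ?thesis .
qed

text \<open>
  The reflection \<open>x \<mapsto> p - x\<close> reverses the order of the entries, changes their parities, and turns
  each inverse into its negative. The new entries alternate again; the shift \<open>e'\<close> is determined by
  the new last entry, which is \<open>p\<close> minus the old first one and so depends on the length.
\<close>

lemma parity_sum_reversal:
  assumes p: "prime p" "odd p" and e: "even (length s + e + e')"
  shows "[parity_sum e' (rev s) p = (-1) ^ sum_list s * parity_sum e s p] (mod int p)"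
proof -
  let ?d = "length s" and ?r = "\<lambda>ns. rev (map (\<lambda>x. p - x) ns)"
  have inv: "?r (?r ns) = ns" if "set ns \<subseteq> {0<..<p}" for ns
  proof -
    have "?r (?r ns) = map (\<lambda>x. p - (p - x)) ns" by (simp add: rev_map o_def)
    also have "\<dots> = ns" using that by (intro map_idI) auto
    finally show ?thesis .
  qed
  have "parity_sum e' (rev s) p =
      (\<Sum>ns\<in>index_tuples e ?d p. 2 ^ ?d * tuple_term p (rev s) (?r ns))"
    unfolding parity_sum_eq_tuple_sum length_rev
  proof (rule sum.reindex_bij_witness[of _ ?r ?r])
    fix ns assume ns: "ns \<in> index_tuples e ?d p"
    then show "?r (?r ns) = ns" by (intro inv) (auto simp: index_tuples_iff)
    show "?r ns \<in> index_tuples e' ?d p" by (rule rev_in_index_tuples[OF p(2) e ns])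
  next
    fix ns assume ns: "ns \<in> index_tuples e' ?d p"
    then show rr: "?r (?r ns) = ns" by (intro inv) (auto simp: index_tuples_iff)
    show "?r ns \<in> index_tuples e ?d p"
      by (rule rev_in_index_tuples[OF p(2) _ ns]) (use e in auto)
    show "2 ^ ?d * tuple_term p (rev s) (?r (?r ns)) = 2 ^ ?d * tuple_term p (rev s) ns"
      by (simp only: rr)
  qed
  also have "[\<dots> = (\<Sum>ns\<in>index_tuples e ?d p. 2 ^ ?d * ((-1) ^ sum_list s * tuple_term p s ns))] (mod int p)"
    by (intro cong_sum cong_mult cong_refl tuple_term_reflect p) (auto simp: index_tuples_iff)
  also have "(\<Sum>ns\<in>index_tuples e ?d p. 2 ^ ?d * ((-1) ^ sum_list s * tuple_term p s ns)) =
      (-1) ^ sum_list s * parity_sum e s p"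
    by (simp add: parity_sum_eq_tuple_sum sum_distrib_left mult_ac)
  finally show ?thesis .
qed


section \<open>Duality\<close>

lemma parity_sum_double_sum:
  assumes p: "prime p" and k: "Suc k < p - 1"
  shows "[parity_sum 1 ([n, 2] @ replicate k 1) p =
    - 4 * (\<Sum>a\<in>parity_class p k. \<Sum>b\<in>parity_class p k.
        inv_mod p a ^ n * inv_mod p b ^ Suc k * mittag_leffler_sum p a b)] (mod int p)"
proof -
  let ?s = "[n, 2] @ replicate k 1"
  have "parity_sum 1 ?s p = (\<Sum>a<p. alt_sum p ?s a)"
    using p by (intro parity_sum_eq_alt_sum) (simp add: prime_gt_0_nat)
  also have "\<dots> = (\<Sum>a\<in>parity_class p k. alt_sum p ?s a)"
  proof (rule sum.mono_neutral_right)
    show "\<forall>a\<in>{..<p} - parity_class p k. alt_sum p ?s a = 0"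
    proof
      fix a assume a: "a \<in> {..<p} - parity_class p k"
      show "alt_sum p ?s a = 0"
      proof (cases "a = 0")
        case False
        with a show ?thesis by (intro alt_sum_parity) (auto simp: parity_class_def)
      qed simp
    qed
  qed (auto simp: parity_class_def)
  also have "[\<dots> = (\<Sum>a\<in>parity_class p k. - 4 * (\<Sum>b\<in>parity_class p k.
        inv_mod p a ^ n * inv_mod p b ^ Suc k * mittag_leffler_sum p a b))] (mod int p)"
    by (intro cong_sum alt_sum_two_ones p k) (auto simp: parity_class_def)
  finally show ?thesis by (simp only: sum_distrib_left)
qed

text \<open>
  For even \<open>k\<close> the defect vanishes at all \<open>a\<close> in question. For odd \<open>k\<close> the exponent \<open>q\<close> is
  even, and the second factor is half of a power sum over all nonzero residues.
\<close>

lemma defect_sum_vanishes: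
  assumes p: "prime p" and q: "0 < q" "q < p - 1" and qk: "odd (q + k)"
  shows "[(\<Sum>a\<in>parity_class p k. f a * defect p a) * (\<Sum>b\<in>parity_class p k. inv_mod p b ^ q) = 0] (mod int p)"
proof (cases "even k")
  case True
  then have "(\<Sum>a\<in>parity_class p k. f a * defect p a) = 0"
    by (intro sum.neutral) (auto simp: defect_def parity_class_def)
  then show ?thesis by simp
next
  case False
  then have "even q" using qk by simp
  from cong_mult[OF cong_refl even_power_sum_parity_class[OF p q this]] show ?thesis by simp
qed

lemma cong_add_zero_cancel:
  fixes x y u v m :: int
  assumes "[x + u = y + v] (mod m)" "[u = 0] (mod m)" "[v = 0] (mod m)"
  shows "[x = y] (mod m)"
  using cong_diff[OF assms(1) cong_trans[OF assms(2) cong_sym[OF assms(3)]]] by simp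

text \<open>
  As \<open>n - 1\<close> and \<open>k\<close> have the same parity, the double sums of the two sides range over the same
  pairs, and after exchanging the names of \<open>a\<close> and \<open>b\<close> they carry the same weights. They differ
  only in the order of the arguments of \<open>mittag_leffler_sum\<close>, which the reciprocity law reverses at the
  cost of defects whose weighted sums vanish.
\<close>

lemma parity_sum_duality:
  assumes p: "prime p" and n: "0 < n" "n < p - 1" and k: "Suc k < p - 1" and nk: "odd (n + k)"
  shows "[parity_sum 1 ([n, 2] @ replicate k 1) p =
    parity_sum 1 ([Suc k, 2] @ replicate (n - 1) 1) p] (mod int p)"
proof -
  let ?R = "parity_class p k"
  let ?w = "\<lambda>a b. inv_mod p a ^ n * inv_mod p b ^ Suc k"
  have R: "parity_class p (n - 1) = ?R"
    using n nk by (auto simp: parity_class_def)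
  have left: "[parity_sum 1 ([n, 2] @ replicate k 1) p =
      - 4 * (\<Sum>a\<in>?R. \<Sum>b\<in>?R. ?w a b * mittag_leffler_sum p a b)] (mod int p)"
    by (rule parity_sum_double_sum[OF p k])
  have "[parity_sum 1 ([Suc k, 2] @ replicate (n - 1) 1) p =
      - 4 * (\<Sum>b\<in>?R. \<Sum>a\<in>?R. inv_mod p b ^ Suc k * inv_mod p a ^ n * mittag_leffler_sum p b a)] (mod int p)"
    using parity_sum_double_sum[OF p, of "n - 1" "Suc k"] n by (simp only: R Suc_diff_1)
  also have "(\<Sum>b\<in>?R. \<Sum>a\<in>?R. inv_mod p b ^ Suc k * inv_mod p a ^ n * mittag_leffler_sum p b a) =
      (\<Sum>a\<in>?R. \<Sum>b\<in>?R. ?w a b * mittag_leffler_sum p b a)"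
    by (subst sum.swap) (simp add: mult_ac)
  finally have right: "[parity_sum 1 ([Suc k, 2] @ replicate (n - 1) 1) p =
      - 4 * (\<Sum>a\<in>?R. \<Sum>b\<in>?R. ?w a b * mittag_leffler_sum p b a)] (mod int p)" .
  have "[(\<Sum>a\<in>?R. \<Sum>b\<in>?R. ?w a b * (mittag_leffler_sum p a b + defect p b)) =
      (\<Sum>a\<in>?R. \<Sum>b\<in>?R. ?w a b * (mittag_leffler_sum p b a + defect p a))] (mod int p)"
    by (intro cong_sum cong_mult cong_refl mittag_leffler_sum_reciprocity p) (auto simp: parity_class_def)
  moreover have "(\<Sum>a\<in>?R. \<Sum>b\<in>?R. ?w a b * (mittag_leffler_sum p a b + defect p b)) =
      (\<Sum>a\<in>?R. \<Sum>b\<in>?R. ?w a b * mittag_leffler_sum p a b)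
      + (\<Sum>b\<in>?R. inv_mod p b ^ Suc k * defect p b) * (\<Sum>a\<in>?R. inv_mod p a ^ n)"
    unfolding sum_product distrib_left sum.distrib by (subst (3) sum.swap) (simp add: mult_ac)
  moreover have "(\<Sum>a\<in>?R. \<Sum>b\<in>?R. ?w a b * (mittag_leffler_sum p b a + defect p a)) =
      (\<Sum>a\<in>?R. \<Sum>b\<in>?R. ?w a b * mittag_leffler_sum p b a)
      + (\<Sum>a\<in>?R. inv_mod p a ^ n * defect p a) * (\<Sum>b\<in>?R. inv_mod p b ^ Suc k)"
    unfolding sum_product distrib_left sum.distrib by (simp add: mult_ac)
  moreover have "[(\<Sum>b\<in>?R. inv_mod p b ^ Suc k * defect p b) * (\<Sum>a\<in>?R. inv_mod p a ^ n) = 0] (mod int p)"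
    using n nk by (intro defect_sum_vanishes p) auto
  moreover have "[(\<Sum>a\<in>?R. inv_mod p a ^ n * defect p a) * (\<Sum>b\<in>?R. inv_mod p b ^ Suc k) = 0] (mod int p)"
    using k by (intro defect_sum_vanishes p) auto
  ultimately have balance: "[(\<Sum>a\<in>?R. \<Sum>b\<in>?R. ?w a b * mittag_leffler_sum p a b) =
      (\<Sum>a\<in>?R. \<Sum>b\<in>?R. ?w a b * mittag_leffler_sum p b a)] (mod int p)"
    by (simp only:) (rule cong_add_zero_cancel)
  note left
  also note cong_mult[OF cong_refl[of "- 4"] balance]
  also note cong_sym[OF right]
  finally show ?thesis .
qed

lemma class_A_eqI:
  assumes "\<And>p. prime p \<Longrightarrow> N < p \<Longrightarrow> [f p = g p] (mod int p)"
  shows "class_A f = class_A g"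
proof -
  have "{p. prime p \<and> \<not> [f p = g p] (mod int p)} \<subseteq> {..N}"
    using assms by (auto simp: not_less[symmetric])
  then show ?thesis
    unfolding class_A_eq_iff by (rule finite_subset) simp
qed

lemma T_A_duality:
  assumes "0 < n" "odd (n + k)"
  shows "T_A ([n, 2] @ replicate k 1) = T_A ([k + 1, 2] @ replicate (n - 1) 1)"
  unfolding T_A_def
proof (rule class_A_eqI[where N = "n + k + 2"])
  fix p assume "prime p" "n + k + 2 < p"
  then have "[parity_sum 1 ([n, 2] @ replicate k 1) p =
      parity_sum 1 ([Suc k, 2] @ replicate (n - 1) 1) p] (mod int p)"
    using assms by (intro parity_sum_duality) auto
  then show "[parity_sum 1 ([n, 2] @ replicate k 1) p =
      parity_sum 1 ([k + 1, 2] @ replicate (n - 1) 1) p] (mod int p)"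
    by (simp only: Suc_eq_plus1)
qed

lemma parity_sum_rev_odd_weight:
  assumes w: "odd (sum_list s)" and e: "even (length s + e + e')" and p: "prime p" "2 < p"
  shows "[parity_sum e s p = - parity_sum e' (rev s) p] (mod int p)"
proof -
  have "[parity_sum e' (rev s) p = - parity_sum e s p] (mod int p)"
    using parity_sum_reversal[OF p(1) prime_odd_nat[OF p] e] w by simp
  then have "[- parity_sum e' (rev s) p = - (- parity_sum e s p)] (mod int p)"
    by (simp only: cong_minus_minus_iff)
  then show ?thesis by (simp add: cong_sym)
qed

lemma T_A_rev_even_length:
  assumes "odd (sum_list s)" "even (length s)"
  shows "T_A s = \<ominus>\<^bsub>ring_A\<^esub> T_A (rev s)"
  unfolding T_A_def a_inv_class_A
  by (rule class_A_eqI[where N = 2], rule parity_sum_rev_odd_weight) (use assms in auto)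

lemma T_A_rev_odd_length:
  assumes "odd (sum_list s)" "odd (length s)"
  shows "T_A s = \<ominus>\<^bsub>ring_A\<^esub> S_A (rev s)"
  unfolding T_A_def S_A_def a_inv_class_A
  by (rule class_A_eqI[where N = 2], rule parity_sum_rev_odd_weight) (use assms in auto)

theorem theorem4p8:
  shows "(\<forall>n k :: nat. n > 0 \<longrightarrow> k > 0 \<longrightarrow> [n + k = 1] (mod 2) \<longrightarrow>
            T_A ([n, 2] @ replicate k 1) = T_A ([k + 1, 2] @ replicate (n - 1) 1))
       \<and> (\<forall>n k :: nat. n > 0 \<longrightarrow> k > 0 \<longrightarrow>
            T_A ([2 * n - 1, 2] @ replicate (2 * k) 1)
              = \<ominus>\<^bsub>ring_A\<^esub> T_A (replicate (2 * n - 2) 1 @ [2, 2 * k + 1])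
          \<and> T_A ([2 * n, 2] @ replicate (2 * k - 1) 1)
              = \<ominus>\<^bsub>ring_A\<^esub> S_A (replicate (2 * n - 1) 1 @ [2, 2 * k]))"
proof (intro conjI allI impI)
  fix n k :: nat
  assume "n > 0" and "[n + k = 1] (mod 2)"
  moreover from this have "odd (n + k)"
    unfolding cong_def odd_iff_mod_2_eq_one by simp
  ultimately show "T_A ([n, 2] @ replicate k 1) = T_A ([k + 1, 2] @ replicate (n - 1) 1)"
    by (intro T_A_duality)
next
  fix n k :: nat
  assume n: "n > 0" and k: "k > 0"
  have "T_A ([2 * n - 1, 2] @ replicate (2 * k) 1) = T_A ([2 * k + 1, 2] @ replicate (2 * n - 1 - 1) 1)"
    using n by (intro T_A_duality) auto
  also have "\<dots> = \<ominus>\<^bsub>ring_A\<^esub> T_A (rev ([2 * k + 1, 2] @ replicate (2 * n - 1 - 1) 1))"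
    using n by (intro T_A_rev_even_length) (auto simp: sum_list_replicate)
  also have "rev ([2 * k + 1, 2] @ replicate (2 * n - 1 - 1) 1) = replicate (2 * n - 2) 1 @ [2, 2 * k + 1]"
    by (simp add: numeral_2_eq_2)
  finally show "T_A ([2 * n - 1, 2] @ replicate (2 * k) 1)
      = \<ominus>\<^bsub>ring_A\<^esub> T_A (replicate (2 * n - 2) 1 @ [2, 2 * k + 1])" .
  have "T_A ([2 * n, 2] @ replicate (2 * k - 1) 1) = T_A ([2 * k - 1 + 1, 2] @ replicate (2 * n - 1) 1)"
    using n k by (intro T_A_duality) auto
  also have "2 * k - 1 + 1 = 2 * k" using k by simp
  also have "T_A ([2 * k, 2] @ replicate (2 * n - 1) 1) = \<ominus>\<^bsub>ring_A\<^esub> S_A (rev ([2 * k, 2] @ replicate (2 * n - 1) 1))"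
    using n by (intro T_A_rev_odd_length) (auto simp: sum_list_replicate)
  also have "rev ([2 * k, 2] @ replicate (2 * n - 1) 1) = replicate (2 * n - 1) 1 @ [2, 2 * k]"
    by simp
  finally show "T_A ([2 * n, 2] @ replicate (2 * k - 1) 1)
      = \<ominus>\<^bsub>ring_A\<^esub> S_A (replicate (2 * n - 1) 1 @ [2, 2 * k])" .
qed

end
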